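(* Let $I\subseteq\mathbb{R}$ be an interval with interior $I^{\circ}$, let $f:I\to\mathbb{R}$ be differentiable on $I^{\circ}$ and such that $f'\in L[a,b]$, where $a,b\in I$ with $a<b$. Suppose $|f'|^{q}$ is concave on $[a,b]$ for some fixed $q\ge1$. Then for every division $d: a=x_0<x_1<\dots<x_{n-1}<x_n=b$ of $[a,b]$, the trapezoidal error satisfies $$|E(f,d)|\le\frac18\sum_{i=0}^{n-1}(x_{i+1}-x_i)^2\left(\left|f'\left(\frac{5x_i+x_{i+1}}{6}\right)\right|+\left|f'\left(\frac{x_i+5x_{i+1}}{6}\right)\right|\right).$$
   Context: $f'\in L[a,b]$ means that $f'$ is (Lebesgue) integrable on $[a,b]$. For a division $d: a=x_0<x_1<\dots<x_n=b$, the trapezoidal sum is $T(f,d)=\sum_{i=0}^{n-1}\frac{f(x_i)+f(x_{i+1})}{2}(x_{i+1}-x_i)$, and the error $E(f,d)$ is defined by $\int_a^b f(x)\,dx=T(f,d)+E(f,d)$.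
   Formalization: f is also assumed differentiable within I at every point of [a,b] (one-sided at a or b when it is an endpoint of I), with f' denoting that derivative; otherwise a jump of f at an endpoint of I, such as f=0 on (0,1] with f(0)=1, violates the bound. *)

theory Defs
  imports "HOL-Analysis.Analysis"
begin

definition is_division :: "real \<Rightarrow> real \<Rightarrow> nat \<Rightarrow> (nat \<Rightarrow> real) \<Rightarrow> bool" where
  "is_division a b n x \<longleftrightarrow> x 0 = a \<and> x n = b \<and> (\<forall>i<n. x i < x (Suc i))"

definition trapezoidal_sum :: "(real \<Rightarrow> real) \<Rightarrow> nat \<Rightarrow> (nat \<Rightarrow> real) \<Rightarrow> real" where
  "trapezoidal_sum f n x = (\<Sum>i<n. (f (x i) + f (x (Suc i))) / 2 * (x (Suc i) - x i))"

definition trapezoidal_error ::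
    "(real \<Rightarrow> real) \<Rightarrow> real \<Rightarrow> real \<Rightarrow> nat \<Rightarrow> (nat \<Rightarrow> real) \<Rightarrow> real" where
  "trapezoidal_error f a b n x = integral {a..b} f - trapezoidal_sum f n x"

end

(*
  Since t^q is convex and increasing, |f'| itself is concave. On a subinterval [u,v] with midpoint m,
  integration by parts gives  E = - integral of (t - m) f'(t),  so |E| is at most the integral of
  |t - m| |f'(t)|. On each half, |t - m| has total mass (v - u)^2 / 8 and barycentre (5u + v)/6 or
  (u + 5v)/6; bounding the concave function |f'| by its supporting line at the barycentre (Jensen)
  gives the claimed bound.
*)
theory Submission
  imports Defs
begin

text \<open>The endpoint 0 is included because the derivative may vanish. If one of the two points
  is 0, convexity reduces to (s z)^p \<le> s z^p for 0 < s < 1, which follows from s^p \<le>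
  s.\<close>

lemma convex_on_powr_nonneg:
  fixes p :: real
  assumes "p \<ge> 1"
  shows "convex_on {0..} (\<lambda>x. x powr p)"
proof (rule convex_onI)
  fix t x y :: real
  assume t: "0 < t" "t < 1" and xy: "x \<in> {0..}" "y \<in> {0..}"
  have scale: "(s * z) powr p \<le> s * z powr p" if "0 < s" "s < 1" "0 \<le> z" for s z :: real
  proof -
    have "s powr p \<le> s powr 1"
      using that assms by (intro powr_mono') auto
    then show ?thesis
      using that by (simp add: powr_mult mult_right_mono)
  qed
  consider "x = 0" | "y = 0" | "0 < x" "0 < y"
    using xy by force
  then show "((1 - t) *\<^sub>R x + t *\<^sub>R y) powr p \<le> (1 - t) * x powr p + t * y powr p"
  proof cases
    case 1
    then show ?thesis using scale[of t y] t xy by simp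
  next
    case 2
    then show ?thesis using scale[of "1 - t" x] t xy by simp
  next
    case 3
    then show ?thesis using convex_onD[OF powr_convex[OF assms], of t x y] t by simp
  qed
qed simp

lemma concave_on_of_powr:
  fixes h :: "'a::real_vector \<Rightarrow> real" and q :: real
  assumes conc: "concave_on S (\<lambda>t. h t powr q)" and "q \<ge> 1" and nonneg: "\<And>t. t \<in> S \<Longrightarrow> 0 \<le> h t"
  shows "concave_on S h"
  unfolding concave_on_iff
proof (intro conjI ballI allI impI)
  show cS: "convex S"
    using conc by (simp add: concave_on_iff)
  fix x y u v
  assume xy: "x \<in> S" "y \<in> S" and uv: "0 \<le> u" "0 \<le> v" "u + v = (1::real)"
  let ?z = "u *\<^sub>R x + v *\<^sub>R y"
  have z: "?z \<in> S"
    using convexD[OF cS] xy uv by blast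
  have "(u * h x + v * h y) powr q \<le> u * h x powr q + v * h y powr q"
    using convex_on_powr_nonneg[OF \<open>q \<ge> 1\<close>] nonneg xy uv by (simp add: convex_on_def)
  also have "\<dots> \<le> h ?z powr q"
    using conc xy uv by (simp add: concave_on_iff)
  \<comment> \<open>The power with exponent q is strictly increasing on nonnegative reals, so the
    opposite strict inequality would contradict the chain just obtained.\<close>
  finally show "u * h x + v * h y \<le> h ?z"
    using powr_less_mono2[of q "h ?z" "u * h x + v * h y"] nonneg[OF z] \<open>q \<ge> 1\<close> by force
qed

lemma concave_on_supporting_line:
  fixes h :: "real \<Rightarrow> real"
  assumes "concave_on S h" "p \<in> interior S"
  obtains c where "\<And>t. t \<in> S \<Longrightarrow> h t \<le> h p + c * (t - p)"
proof -
  \<comment> \<open>\<open>?k\<close> is the right derivative of the convex function -h at p,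
    written as an infimum of difference quotients. It is a subgradient of -h, and its negative is
    the slope of the supporting line of h.\<close>
  let ?k = "Inf ((\<lambda>t. (- h p - - h t) / (p - t)) ` ({p<..} \<inter> S))"
  have "h t \<le> h p + (- ?k) * (t - p)" if "t \<in> S" for t
    using convex_le_Inf_differential[OF assms(1)[unfolded concave_on_def] assms(2) that] by simp
  then show ?thesis by (rule that)
qed

text \<open>The point (2u + m)/3 is the barycentre of [u, m] for the weight m - t. The linear term
  of the bound on |f'| therefore contributes nothing to the weighted integral, and A is multiplied
  only by the total mass (m - u)^2 / 2.\<close>

lemma integral_left_endpoint_error:
  fixes f f' :: "real \<Rightarrow> real"
  assumes "u \<le> m"
    and deriv: "\<And>t. t \<in> {u..m} \<Longrightarrow> (f has_real_derivative f' t) (at t within {u..m})"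
    and bound: "\<And>t. t \<in> {u..m} \<Longrightarrow> \<bar>f' t\<bar> \<le> A + c * (t - (2 * u + m) / 3)"
  shows "\<bar>integral {u..m} f - (m - u) * f u\<bar> \<le> (m - u)\<^sup>2 / 2 * A"
proof -
  have "continuous_on {u..m} f"
    using deriv by (blast intro: DERIV_continuous_on)
  then have f: "f integrable_on {u..m}"
    by (rule integrable_continuous_real)
  \<comment> \<open>The integrand is the derivative of (t - m) f(t). Its boundary term vanishes at
    m, so only the endpoint value f(u) survives.\<close>
  have "((\<lambda>t. f t + (t - m) * f' t) has_integral (m - m) * f m - (u - m) * f u) {u..m}"
    using \<open>u \<le> m\<close>
    by (rule fundamental_theorem_of_calculus)
       (auto simp: has_real_derivative_iff_has_vector_derivative[symmetric]
             intro!: derivative_eq_intros deriv)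
  from has_integral_diff[OF this integrable_integral[OF f]]
  have parts: "((\<lambda>t. (t - m) * f' t) has_integral (m - u) * f u - integral {u..m} f) {u..m}"
    by (simp add: algebra_simps)
  define p where "p = (2 * u + m) / 3"
  \<comment> \<open>This antiderivative comes from splitting t - p = (m - p) + (t - m), which makes
    the integrand a polynomial in t - m and gives G(m) = 0.\<close>
  define G where "G t = - ((t - m)\<^sup>2 / 2 * (A + c * (m - p)) + c * (t - m) ^ 3 / 3)" for t
  have "((\<lambda>t. (m - t) * (A + c * (t - p))) has_integral G m - G u) {u..m}"
    using \<open>u \<le> m\<close> unfolding G_def
    by (intro fundamental_theorem_of_calculus)
       (auto simp: has_real_derivative_iff_has_vector_derivative[symmetric]
             intro!: derivative_eq_intros simp: field_simps power2_eq_square)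
  \<comment> \<open>Since m - p = 2(m - u)/3, the two terms containing c cancel.\<close>
  moreover have "G m - G u = (m - u)\<^sup>2 / 2 * A"
    unfolding G_def p_def by (simp add: field_simps power2_eq_square power3_eq_cube)
  ultimately have line: "((\<lambda>t. (m - t) * (A + c * (t - p))) has_integral (m - u)\<^sup>2 / 2 * A) {u..m}"
    by simp
  have "norm (integral {u..m} (\<lambda>t. (t - m) * f' t)) \<le> integral {u..m} (\<lambda>t. (m - t) * (A + c * (t - p)))"
  proof (rule integral_norm_bound_integral)
    fix t assume t: "t \<in> {u..m}"
    then have "\<bar>f' t\<bar> \<le> A + c * (t - p)"
      using bound unfolding p_def by blast
    then show "norm ((t - m) * f' t) \<le> (m - t) * (A + c * (t - p))"
      using t by (simp add: abs_mult mult_left_mono)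
  qed (use parts line in blast)+
  then show ?thesis
    using integral_unique[OF parts] integral_unique[OF line] by (simp add: abs_minus_commute)
qed

text \<open>The reflection t -> -t turns this into the left-endpoint estimate on [-v, -m]:
  barycentre goes to barycentre, and the slope c changes sign.\<close>

lemma integral_right_endpoint_error:
  fixes f f' :: "real \<Rightarrow> real"
  assumes "m \<le> v"
    and deriv: "\<And>t. t \<in> {m..v} \<Longrightarrow> (f has_real_derivative f' t) (at t within {m..v})"
    and bound: "\<And>t. t \<in> {m..v} \<Longrightarrow> \<bar>f' t\<bar> \<le> A + c * (t - (m + 2 * v) / 3)"
  shows "\<bar>integral {m..v} f - (v - m) * f v\<bar> \<le> (v - m)\<^sup>2 / 2 * A"
proof -
  have "((\<lambda>t. f (- t)) has_real_derivative - f' (- t)) (at t within {- v..- m})"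
    if "t \<in> {- v..- m}" for t
  proof -
    have "(f has_real_derivative f' (- t)) (at (- t) within uminus ` {- v..- m})"
      using deriv[of "- t"] that by simp
    moreover have "(uminus has_real_derivative - 1) (at t within {- v..- m})"
      by (auto intro!: derivative_eq_intros)
    ultimately show ?thesis
      using DERIV_image_chain[of f "f' (- t)" uminus t "{- v..- m}" "- 1"] by (simp add: o_def)
  qed
  moreover have "\<bar>- f' (- t)\<bar> \<le> A + (- c) * (t - (2 * (- v) + (- m)) / 3)" if "t \<in> {- v..- m}" for t
    using bound[of "- t"] that by (simp add: field_simps)
  ultimately have "\<bar>integral {- v..- m} (\<lambda>t. f (- t)) - (- m - (- v)) * f (- (- v))\<bar>
      \<le> (- m - (- v))\<^sup>2 / 2 * A"
    using \<open>m \<le> v\<close>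
    by (intro integral_left_endpoint_error[where f' = "\<lambda>t. - f' (- t)" and c = "- c"]) auto
  then show ?thesis
    by (simp add: Henstock_Kurzweil_Integration.integral_reflect_real)
qed

text \<open>The trapezoid has the same area as two rectangles: one of height f(u) on the left half
  and one of height f(v) on the right half. The error thus splits into the two endpoint errors, and
  (m - u)^2 / 2 = (v - u)^2 / 8 yields the constant.\<close>

lemma trapezoid_error:
  fixes f f' :: "real \<Rightarrow> real"
  assumes "u < v"
    and deriv: "\<And>t. t \<in> {u..v} \<Longrightarrow> (f has_real_derivative f' t) (at t within {u..v})"
    and conc: "concave_on {u..v} (\<lambda>t. \<bar>f' t\<bar>)"
  shows "\<bar>integral {u..v} f - (f u + f v) / 2 * (v - u)\<bar>
    \<le> 1 / 8 * ((v - u)\<^sup>2 * (\<bar>f' ((5 * u + v) / 6)\<bar> + \<bar>f' ((u + 5 * v) / 6)\<bar>))"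
proof -
  define m where "m = (u + v) / 2"
  have m: "u \<le> m" "m \<le> v" and left: "(2 * u + m) / 3 = (5 * u + v) / 6"
    and right: "(m + 2 * v) / 3 = (u + 5 * v) / 6"
    and half: "m - u = (v - u) / 2" "v - m = (v - u) / 2"
    using \<open>u < v\<close> by (auto simp: m_def field_simps)
  have interior: "(5 * u + v) / 6 \<in> interior {u..v}" "(u + 5 * v) / 6 \<in> interior {u..v}"
    using \<open>u < v\<close> by auto
  obtain c where c: "\<And>t. t \<in> {u..v} \<Longrightarrow> \<bar>f' t\<bar> \<le> \<bar>f' ((5 * u + v) / 6)\<bar> + c * (t - (5 * u + v) / 6)"
    using concave_on_supporting_line[OF conc interior(1)] by blast
  obtain d where d: "\<And>t. t \<in> {u..v} \<Longrightarrow> \<bar>f' t\<bar> \<le> \<bar>f' ((u + 5 * v) / 6)\<bar> + d * (t - (u + 5 * v) / 6)"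
    using concave_on_supporting_line[OF conc interior(2)] by blast
  have "\<bar>integral {u..m} f - (m - u) * f u\<bar> \<le> (m - u)\<^sup>2 / 2 * \<bar>f' ((5 * u + v) / 6)\<bar>"
    using m by (intro integral_left_endpoint_error[where f' = f' and c = c])
      (auto simp: left intro!: c intro: DERIV_subset[OF deriv])
  moreover have "\<bar>integral {m..v} f - (v - m) * f v\<bar> \<le> (v - m)\<^sup>2 / 2 * \<bar>f' ((u + 5 * v) / 6)\<bar>"
    using m by (intro integral_right_endpoint_error[where f' = f' and c = d])
      (auto simp: right intro!: d intro: DERIV_subset[OF deriv])
  moreover have "integral {u..m} f + integral {m..v} f = integral {u..v} f"
    using m deriv
    by (intro Henstock_Kurzweil_Integration.integral_combine integrable_continuous_real
        DERIV_continuous_on)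
  moreover have "(f u + f v) / 2 * (v - u) = (m - u) * f u + (v - m) * f v"
    unfolding half by (simp add: field_simps)
  moreover have "1 / 8 * ((v - u)\<^sup>2 * (A + B)) = (m - u)\<^sup>2 / 2 * A + (v - m)\<^sup>2 / 2 * B" for A B
    unfolding half by (simp add: power_divide distrib_left)
  from this[of "\<bar>f' ((5 * u + v) / 6)\<bar>" "\<bar>f' ((u + 5 * v) / 6)\<bar>"] calculation show ?thesis
    by linarith
qed

lemma division_mono:
  assumes "is_division a b n x" "i \<le> j" "j \<le> n"
  shows "x i \<le> x j"
  using assms(2,3)
proof (induction j rule: dec_induct)
  case (step k)
  then have "x i \<le> x k" "x k < x (Suc k)"
    using assms(1) by (simp_all add: is_division_def)
  then show ?case by simp
qed simp

lemma integral_division: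
  fixes f :: "real \<Rightarrow> real"
  assumes "is_division a b n x" "f integrable_on {a..b}"
  shows "integral {a..b} f = (\<Sum>i<n. integral {x i..x (Suc i)} f)"
proof -
  have ends: "x 0 = a" "x n = b"
    using assms(1) by (auto simp: is_division_def)
  \<comment> \<open>The induction runs over initial segments with k \<le> n, so that every interval
    met stays inside [a, b], where f is known to be integrable.\<close>
  have "integral {x 0..x k} f = (\<Sum>i<k. integral {x i..x (Suc i)} f)" if "k \<le> n" for k
    using that
  proof (induction k)
    case (Suc k)
    note mono = division_mono[OF assms(1)]
    have "{x 0..x (Suc k)} \<subseteq> {a..b}"
      using mono[of "Suc k" n] Suc.prems ends by auto
    then have "f integrable_on {x 0..x (Suc k)}"
      using assms(2) integrable_on_subinterval by blast
    then have "integral {x 0..x k} f + integral {x k..x (Suc k)} f = integral {x 0..x (Suc k)} f"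
      using mono[of 0 k] mono[of k "Suc k"] Suc.prems
      by (intro Henstock_Kurzweil_Integration.integral_combine) auto
    then show ?case
      using Suc by simp
  qed simp
  from this[of n] show ?thesis
    by (simp add: ends)
qed

theorem proposition5:
  fixes I :: "real set" and f f' :: "real \<Rightarrow> real" and a b q :: real
    and n :: nat and x :: "nat \<Rightarrow> real"
  assumes "is_interval I"
    and "a \<in> I" and "b \<in> I" and "a < b"
    and "\<And>t. t \<in> interior I \<Longrightarrow> (f has_real_derivative f' t) (at t)"
    and "\<And>t. t \<in> {a..b} \<Longrightarrow> (f has_real_derivative f' t) (at t within I)"
    and "set_integrable lebesgue {a..b} f'"
    and "q \<ge> 1"
    and "concave_on {a..b} (\<lambda>t. \<bar>f' t\<bar> powr q)"
    and "is_division a b n x"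
  shows "\<bar>trapezoidal_error f a b n x\<bar>
    \<le> 1 / 8 * (\<Sum>i<n. (x (Suc i) - x i)\<^sup>2 *
        (\<bar>f' ((5 * x i + x (Suc i)) / 6)\<bar> + \<bar>f' ((x i + 5 * x (Suc i)) / 6)\<bar>))"
proof -
  have "{a..b} \<subseteq> I"
    using assms(1-3) by (meson atLeastAtMost_iff mem_is_interval_1_I subsetI)
  \<comment> \<open>Restricting from I to [a, b] leaves one-sided derivatives at a and b, which is
    what integration by parts on closed subintervals uses.\<close>
  then have deriv: "(f has_real_derivative f' t) (at t within {a..b})" if "t \<in> {a..b}" for t
    using DERIV_subset[OF assms(6)[OF that]] by blast
  have conc: "concave_on {a..b} (\<lambda>t. \<bar>f' t\<bar>)"
    using concave_on_of_powr[OF assms(9,8)] by simp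
  have "f integrable_on {a..b}"
    using deriv by (blast intro: integrable_continuous_real DERIV_continuous_on)
  then have error: "trapezoidal_error f a b n x
      = (\<Sum>i<n. integral {x i..x (Suc i)} f - (f (x i) + f (x (Suc i))) / 2 * (x (Suc i) - x i))"
    using integral_division[OF assms(10)]
    by (simp add: trapezoidal_error_def trapezoidal_sum_def sum_subtractf)
  show ?thesis
    \<comment> \<open>With the factor 1/8 inside the sum, the triangle inequality reduces the claim
      to one subinterval at a time.\<close>
    unfolding error sum_distrib_left
  proof (rule order_trans[OF sum_abs sum_mono])
    fix i assume "i \<in> {..<n}"
    then have i: "x i < x (Suc i)" and sub: "{x i..x (Suc i)} \<subseteq> {a..b}"
      using assms(10) division_mono[OF assms(10), of 0 i] division_mono[OF assms(10), of "Suc i" n]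
      by (auto simp: is_division_def)
    have "concave_on {x i..x (Suc i)} (\<lambda>t. \<bar>f' t\<bar>)"
      using conc sub unfolding concave_on_def by (rule convex_on_subset) simp
    moreover have "(f has_real_derivative f' t) (at t within {x i..x (Suc i)})"
      if "t \<in> {x i..x (Suc i)}" for t
      using DERIV_subset[OF deriv sub] that sub by blast
    ultimately show "\<bar>integral {x i..x (Suc i)} f - (f (x i) + f (x (Suc i))) / 2 * (x (Suc i) - x i)\<bar>
        \<le> 1 / 8 * ((x (Suc i) - x i)\<^sup>2 *
        (\<bar>f' ((5 * x i + x (Suc i)) / 6)\<bar> + \<bar>f' ((x i + 5 * x (Suc i)) / 6)\<bar>))"
      using trapezoid_error[OF i] by blast
  qed
qed

end
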